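(* Let $L$ be a cyclic Galois extension of a field $K$ of degree $n$ with $\operatorname{Gal}(L/K)=\langle\sigma\rangle$. Let $k$ be an integer satisfying $1\le k\le n$ and let $b_1,\ldots,b_k$ be elements of $L$. Then $b_1,\ldots,b_k$ are linearly dependent over $K$ if and only if $\det S=0$, where $S$ is the $k\times k$ matrix $$S=\left(\sigma^{i-1}(b_j)\right)_{1\le i,j\le k}=\begin{pmatrix} b_1&b_2&\cdots&b_k\\ \sigma(b_1)&\sigma(b_2)&\cdots&\sigma(b_k)\\ \vdots&\vdots&&\vdots\\ \sigma^{k-1}(b_1)&\sigma^{k-1}(b_2)&\cdots&\sigma^{k-1}(b_k)\end{pmatrix}.$$
   Context: The field $K$ has arbitrary characteristic. A cyclic Galois extension is a Galois extension whose Galois group is cyclic; $\sigma$ denotes a generator of $\operatorname{Gal}(L/K)$. *)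

theory Defs
  imports
    "HOL-Algebra.Generated_Groups"
    "HOL-Computational_Algebra.Polynomial"
    "HOL-Computational_Algebra.Polynomial_Factorial"
    "Jordan_Normal_Form.Determinant"
begin

text \<open>
  A field extension L/K is given by a field homomorphism emb from the type 'k (the field K)
  to the type 'l (the field L). Homomorphisms of fields are automatically injective, so
  K is identified with the range of emb, and a scalar c acts on L as multiplication by emb c.
  Polynomials over K have type 'k poly and are evaluated in L via map_poly emb.
\<close>

definition ext_scale :: "('k::field \<Rightarrow> 'l::field) \<Rightarrow> 'k \<Rightarrow> 'l \<Rightarrow> 'l" where
  "ext_scale emb c x = emb c * x"

text \<open>
  As usual for dim, the value is 0 when L is infinite-dimensional over K, so a positive value
  of the degree entails that the extension is finite.
\<close>

definition ext_degree :: "('k::field \<Rightarrow> 'l::field) \<Rightarrow> nat" where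
  "ext_degree emb = vector_space.dim (ext_scale emb) UNIV"

definition algebraic_ext :: "('k::field \<Rightarrow> 'l::field) \<Rightarrow> bool" where
  "algebraic_ext emb \<longleftrightarrow> (\<forall>x. \<exists>p. p \<noteq> 0 \<and> poly (map_poly emb p) x = 0)"

definition poly_splits :: "'a::field poly \<Rightarrow> bool" where
  "poly_splits q \<longleftrightarrow> (\<exists>c as. q = smult c (\<Prod>a\<leftarrow>as. [:- a, 1:]))"

definition normal_ext :: "('k::field \<Rightarrow> 'l::field) \<Rightarrow> bool" where
  "normal_ext emb \<longleftrightarrow> algebraic_ext emb \<and>
     (\<forall>p. irreducible p \<and> (\<exists>x. poly (map_poly emb p) x = 0) \<longrightarrow> poly_splits (map_poly emb p))"

text \<open>
  The irreducible polynomials over K with a root x in L are, up to a nonzero scalar, the minimal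
  polynomials of the elements x of L. A polynomial is separable if it is coprime to its formal
  derivative, that is, if it has no repeated root in any extension field.
\<close>

definition separable_ext :: "('k::field \<Rightarrow> 'l::field) \<Rightarrow> bool" where
  "separable_ext emb \<longleftrightarrow> algebraic_ext emb \<and>
     (\<forall>p. irreducible p \<and> (\<exists>x. poly (map_poly emb p) x = 0) \<longrightarrow> coprime p (pderiv p))"

definition galois_ext :: "('k::field \<Rightarrow> 'l::field) \<Rightarrow> bool" where
  "galois_ext emb \<longleftrightarrow> field_hom emb \<and> normal_ext emb \<and> separable_ext emb"

definition galois_group :: "('k::field \<Rightarrow> 'l::field) \<Rightarrow> ('l \<Rightarrow> 'l) monoid" where
  "galois_group emb =
     \<lparr>carrier = {\<tau>. field_hom \<tau> \<and> bij \<tau> \<and> (\<forall>a. \<tau> (emb a) = emb a)},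
      monoid.mult = (\<circ>), one = id\<rparr>"

text \<open>
  Linear dependence of a family rather than of the set of its members: a family with a repeated
  member is dependent.
\<close>

definition lin_dep_family ::
    "('k::field \<Rightarrow> 'l::field) \<Rightarrow> 'i set \<Rightarrow> ('i \<Rightarrow> 'l) \<Rightarrow> bool" where
  "lin_dep_family emb I b \<longleftrightarrow>
     (\<exists>c :: 'i \<Rightarrow> 'k. (\<exists>i\<in>I. c i \<noteq> 0) \<and> (\<Sum>i\<in>I. ext_scale emb (c i) (b i)) = 0)"

lemma vector_space_ext_scale:
  assumes "field_hom emb"
  shows "vector_space (ext_scale emb)"
proof -
  interpret field_hom emb by fact
  show ?thesis
    by unfold_locales (simp_all add: ext_scale_def algebra_simps hom_distribs)
qed

lemma group_galois_group:
  fixes emb :: "'k::field \<Rightarrow> 'l::field"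
  shows "group (galois_group emb)"
proof (rule groupI)
  fix \<tau> assume "\<tau> \<in> carrier (galois_group emb)"
  hence t: "field_hom \<tau>" "bij \<tau>" "\<And>a. \<tau> (emb a) = emb a"
    by (auto simp: galois_group_def)
  interpret field_hom \<tau> by fact
  have s: "\<tau> (inv_into UNIV \<tau> x) = x" for x
    using t(2) by (simp add: bij_is_surj surj_f_inv_f)
  have i: "inv_into UNIV \<tau> y = x \<longleftrightarrow> y = \<tau> x" for x y
    using t(2) by (metis bij_inv_eq_iff)
  have "field_hom (inv_into UNIV \<tau>)"
    by unfold_locales (simp_all add: i s hom_distribs)
  moreover have "inv_into UNIV \<tau> \<circ> \<tau> = id"
    using t(2) by (simp add: bij_is_inj)
  ultimately show "\<exists>\<rho>\<in>carrier (galois_group emb). \<rho> \<otimes>\<^bsub>galois_group emb\<^esub> \<tau> = \<one>\<^bsub>galois_group emb\<^esub>"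
    using t by (intro bexI[of _ "inv_into UNIV \<tau>"]) (auto simp: galois_group_def i bij_imp_bij_inv)
next
  fix \<rho> \<tau> assume "\<rho> \<in> carrier (galois_group emb)" "\<tau> \<in> carrier (galois_group emb)"
  hence t: "field_hom \<rho>" "field_hom \<tau>" "bij \<rho>" "bij \<tau>"
      "\<And>a. \<rho> (emb a) = emb a" "\<And>a. \<tau> (emb a) = emb a"
    by (auto simp: galois_group_def)
  interpret r: field_hom \<rho> by fact
  interpret t: field_hom \<tau> by fact
  have "field_hom (\<rho> \<circ> \<tau>)"
    by unfold_locales (simp_all add: hom_distribs)
  with t show "\<rho> \<otimes>\<^bsub>galois_group emb\<^esub> \<tau> \<in> carrier (galois_group emb)"
    by (simp add: galois_group_def bij_comp)
next
  have "field_hom (id :: 'l \<Rightarrow> 'l)" by unfold_locales simp_all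
  thus "\<one>\<^bsub>galois_group emb\<^esub> \<in> carrier (galois_group emb)"
    by (simp add: galois_group_def)
qed (simp_all add: galois_group_def comp_assoc)

end

theory Submission
  imports Defs "Jordan_Normal_Form.Char_Poly"
begin

text \<open>
  One direction is immediate: \<open>\<sigma>\<close> fixes \<open>K\<close>, so a \<open>K\<close>-linear relation among the \<open>b\<^sub>j\<close> is
  inherited by every row of \<open>S\<close> and is a relation among its columns.

  For the converse, \<open>S\<close> is the Casoratian of the \<open>b\<^sub>j\<close> for the difference operator \<open>\<sigma>\<close>. As for
  Wronskians, if it vanishes, then the \<open>b\<^sub>j\<close> are dependent over the field of constants, here
  the fixed field of \<open>\<sigma>\<close> (\<open>column_relation_over_fixed_field\<close>): a shortest relation among the
  columns, scaled to contain a coefficient 1, has all its coefficients fixed by \<open>\<sigma>\<close>.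

  It remains to see that the fixed field is no larger than \<open>K\<close>
  (\<open>galois_group_fixed_field\<close>); as \<open>\<sigma>\<close> generates the group, fixing \<open>x\<close> means being fixed by
  every automorphism. Let \<open>x\<close> lie outside \<open>K\<close>. Its minimal polynomial splits with distinct
  roots, so there is a root \<open>y\<close> other than \<open>x\<close> (\<open>second_root_exists\<close>). The assignment
  \<open>x \<mapsto> y\<close> defines a \<open>K\<close>-homomorphism on \<open>K[x]\<close>, and adjoining the members of a finite
  spanning set one after the other, each time choosing a root of the transported minimal
  polynomial in \<open>L\<close>, extends it to an automorphism of \<open>L\<close> that moves \<open>x\<close>. Subfields between
  \<open>K\<close> and \<open>L\<close> are represented as subsets closed under addition and multiplication and
  containing \<open>K\<close>; closure under inverses follows from algebraicity (\<open>inverse_in\<close>).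
\<close>

section \<open>Polynomials with coefficients in an intermediate ring\<close>

definition polys_over :: "'a::zero set \<Rightarrow> 'a poly set" where
  "polys_over F = {p. \<forall>i. coeff p i \<in> F}"

locale intermediate_ring = field_hom emb
  for emb :: "'k::field \<Rightarrow> 'l::field" +
  fixes F :: "'l set"
  assumes base_in: "emb c \<in> F"
    and add_in: "x \<in> F \<Longrightarrow> y \<in> F \<Longrightarrow> x + y \<in> F"
    and mult_in: "x \<in> F \<Longrightarrow> y \<in> F \<Longrightarrow> x * y \<in> F"
begin

lemma zero_in: "0 \<in> F" and one_in: "1 \<in> F"
  using base_in[of 0] base_in[of 1] by simp_all

lemma uminus_in: "x \<in> F \<Longrightarrow> - x \<in> F"
  using mult_in[OF base_in[of "- 1"], of x] by (simp add: hom_distribs)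

lemma diff_in: "x \<in> F \<Longrightarrow> y \<in> F \<Longrightarrow> x - y \<in> F"
  using add_in[of x "- y"] uminus_in[of y] by simp

lemma sum_in: "(\<And>i. i \<in> I \<Longrightarrow> f i \<in> F) \<Longrightarrow> sum f I \<in> F"
  by (induction I rule: infinite_finite_induct) (auto simp: zero_in add_in)

lemma polys_over_diff: "p \<in> polys_over F \<Longrightarrow> q \<in> polys_over F \<Longrightarrow> p - q \<in> polys_over F"
  by (simp add: polys_over_def diff_in)

lemma polys_over_add: "p \<in> polys_over F \<Longrightarrow> q \<in> polys_over F \<Longrightarrow> p + q \<in> polys_over F"
  by (simp add: polys_over_def add_in)

lemma polys_over_mult: "p \<in> polys_over F \<Longrightarrow> q \<in> polys_over F \<Longrightarrow> p * q \<in> polys_over F"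
  by (auto simp: polys_over_def coeff_mult intro!: sum_in mult_in)

lemma polys_over_monom: "c \<in> F \<Longrightarrow> monom c i \<in> polys_over F"
  by (simp add: polys_over_def zero_in)

lemma polys_over_const: "c \<in> F \<Longrightarrow> [:c:] \<in> polys_over F"
  using polys_over_monom[of c 0] by (simp add: monom_0)

lemma polys_over_base: "map_poly emb p \<in> polys_over F"
  by (simp add: polys_over_def base_in coeff_map_poly)

lemma poly_in: "p \<in> polys_over F \<Longrightarrow> x \<in> F \<Longrightarrow> poly p x \<in> F"
proof (induction p)
  case (pCons a p)
  have "coeff (pCons a p) 0 \<in> F" "\<forall>i. coeff (pCons a p) (Suc i) \<in> F"
    using pCons.prems by (auto simp only: polys_over_def mem_Collect_eq)
  with pCons show ?case
    by (auto simp: polys_over_def intro!: add_in mult_in)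
qed (simp add: zero_in)

end


section \<open>Minimal polynomials\<close>

text \<open>
  Over the base field the minimal polynomial is characterised by having least degree among
  the nonzero polynomials vanishing at \<open>x\<close>; a proper factorisation would contain a factor of
  smaller degree vanishing at \<open>x\<close>, which gives irreducibility.
\<close>

lemma minimal_poly_exists:
  fixes emb :: "'k::field \<Rightarrow> 'l::field"
  assumes "field_hom emb" and alg: "algebraic_ext emb"
  obtains p where "irreducible p" "p \<noteq> 0" "poly (map_poly emb p) x = 0"
    "\<And>q. q \<noteq> 0 \<Longrightarrow> poly (map_poly emb q) x = 0 \<Longrightarrow> degree p \<le> degree q"
proof -
  interpret field_hom emb by fact
  interpret P: map_poly_inj_idom_hom emb ..
  define P where "P p \<longleftrightarrow> p \<noteq> 0 \<and> poly (map_poly emb p) x = 0" for p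
  define p where "p = arg_min degree P"
  have "\<exists>q. P q"
    using alg by (auto simp: algebraic_ext_def P_def)
  then have p: "P p"
    unfolding p_def by (metis arg_min_nat_lemma)
  have min: "degree p \<le> degree q" if "P q" for q
    using arg_min_nat_le[of P, OF that] by (simp add: p_def)
  have "irreducible p"
  proof (rule irreducibleI)
    show "p \<noteq> 0" using p by (simp add: P_def)
    show "\<not> p dvd 1"
    proof
      assume "p dvd 1"
      then have "degree p = 0" using \<open>p \<noteq> 0\<close> by (simp add: is_unit_iff_degree)
      then obtain c where "p = [:c:]" by (rule degree_eq_zeroE)
      then show False using p by (simp add: P_def hom_distribs)
    qed
    fix a b assume ab: "p = a * b"
    have nz: "a \<noteq> 0" "b \<noteq> 0" using p ab by (auto simp: P_def)
    have "poly (map_poly emb a) x = 0 \<or> poly (map_poly emb b) x = 0"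
      using p ab by (simp add: P_def hom_distribs)
    then have "P a \<or> P b" using nz by (auto simp: P_def)
    then have "degree a = 0 \<or> degree b = 0"
      using min[of a] min[of b] nz by (auto simp: ab degree_mult_eq)
    then show "a dvd 1 \<or> b dvd 1"
      using nz by (auto simp: is_unit_iff_degree)
  qed
  then show ?thesis using p min that unfolding P_def by blast
qed

context intermediate_ring
begin

text \<open>
  If \<open>p\<close> is the minimal polynomial of \<open>x\<close>, then \<open>p = c + X q\<close> with \<open>c \<noteq> 0\<close>, whence
  \<open>1/x = - q(x)/c\<close>: an intermediate ring of an algebraic extension is a field.
\<close>

lemma inverse_in:
  assumes alg: "algebraic_ext emb" and x: "x \<in> F" "x \<noteq> 0"
  shows "inverse x \<in> F"
proof -
  obtain p where p: "p \<noteq> 0" "poly (map_poly emb p) x = 0"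
    "\<And>q. q \<noteq> 0 \<Longrightarrow> poly (map_poly emb q) x = 0 \<Longrightarrow> degree p \<le> degree q"
    using minimal_poly_exists[OF field_hom_axioms alg] by metis
  obtain c q where cq: "p = pCons c q" by (cases p)
  have eq: "emb c + x * poly (map_poly emb q) x = 0"
    using p(2) by (simp add: cq hom_distribs)
  have "c \<noteq> 0"
  proof
    assume "c = 0"
    then have "q \<noteq> 0" "poly (map_poly emb q) x = 0"
      using p(1) cq eq x(2) by auto
    with p(3)[of q] show False by (simp add: cq)
  qed
  then have "inverse x = emb (- inverse c) * poly (map_poly emb q) x"
    using eq x(2) by (simp add: hom_distribs field_simps eq_neg_iff_add_eq_0)
  then show ?thesis
    using mult_in[OF base_in poly_in[OF polys_over_base x(1)]] by metis
qed

text \<open>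
  The minimal polynomial of \<open>a\<close> over \<open>F\<close>. Divisibility has to hold inside \<open>F[X]\<close>, since
  the cofactor will later be transported along a homomorphism that is multiplicative on
  \<open>F\<close> only; division by a monic polynomial over \<open>F\<close> does not leave \<open>F[X]\<close>.
\<close>

lemma minimal_poly_over_exists:
  assumes alg: "algebraic_ext emb"
  obtains m where "m \<in> polys_over F" "lead_coeff m = 1" "poly m a = 0" "degree m > 0"
    "\<And>f. f \<in> polys_over F \<Longrightarrow> poly f a = 0 \<Longrightarrow> \<exists>q\<in>polys_over F. f = m * q"
proof -
  define P where "P p \<longleftrightarrow> p \<in> polys_over F \<and> p \<noteq> 0 \<and> poly p a = 0" for p
  define g where "g = arg_min degree P"
  interpret P: map_poly_inj_idom_hom emb ..
  obtain p where "p \<noteq> 0" "poly (map_poly emb p) a = 0"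
    using alg unfolding algebraic_ext_def by blast
  then have "P (map_poly emb p)"
    by (auto simp: P_def polys_over_base)
  then have g: "P g"
    unfolding g_def by (metis arg_min_nat_lemma)
  have min: "degree g \<le> degree q" if "P q" for q
    using arg_min_nat_le[of P, OF that] by (simp add: g_def)
  define m where "m = smult (inverse (lead_coeff g)) g"
  have lg: "lead_coeff g \<in> F" "lead_coeff g \<noteq> 0"
    using g by (auto simp: P_def polys_over_def)
  have mF: "m \<in> polys_over F"
    using g inverse_in[OF alg lg] by (simp add: m_def P_def polys_over_def mult_in)
  have deg: "degree m = degree g" and lm: "lead_coeff m = 1"
    using lg(2) by (simp_all add: m_def)
  have root: "poly m a = 0"
    using g by (simp add: m_def P_def)
  have "degree m > 0"
  proof (rule ccontr)
    assume "\<not> degree m > 0"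
    then obtain c where "m = [:c:]" by (auto elim: degree_eq_zeroE)
    then show False using root lm by simp
  qed
  moreover have "\<exists>q\<in>polys_over F. f = m * q" if "f \<in> polys_over F" "poly f a = 0" for f
    using that
  proof (induction "degree f" arbitrary: f rule: less_induct)
    case less
    show ?case
    proof (cases "f = 0")
      case True
      then show ?thesis using less.prems by (intro bexI[of _ 0]) auto
    next
      case False
      have le: "degree m \<le> degree f"
        using min[of f] less.prems False by (simp add: P_def deg)
      define h where "h = monom (lead_coeff f) (degree f - degree m)"
      define f' where "f' = f - m * h"
      have hF: "h \<in> polys_over F"
        using less.prems by (auto simp: h_def polys_over_def zero_in)
      have f'F: "f' \<in> polys_over F" "poly f' a = 0"
        using less.prems hF mF root
        by (auto simp: f'_def intro!: polys_over_diff polys_over_mult)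
      have hn: "h \<noteq> 0" "m \<noteq> 0" using False lm by (auto simp: h_def)
      have dmh: "degree (m * h) = degree f"
        using hn le False by (simp add: degree_mult_eq) (simp add: h_def degree_monom_eq)
      have "lead_coeff (m * h) = lead_coeff f"
        using lm False by (subst lead_coeff_mult) (simp add: h_def degree_monom_eq)
      then have c0: "coeff f' (degree f) = 0"
        by (simp add: f'_def dmh)
      have "degree f' \<le> degree f"
        unfolding f'_def using dmh by (metis degree_diff_le order_refl)
      then have "f' = 0 \<or> degree f' < degree f"
        using c0 by (metis le_neq_implies_less leading_coeff_0_iff)
      then have "\<exists>q\<in>polys_over F. f' = m * q"
      proof
        assume "f' = 0"
        then show ?thesis by (intro bexI[of _ 0]) (simp_all add: polys_over_def zero_in)
      qed (use less.hyps f'F in blast)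
      then obtain q where "q \<in> polys_over F" "f' = m * q" by blast
      then show ?thesis
        using hF by (intro bexI[of _ "q + h"]) (auto simp: f'_def algebra_simps polys_over_add)
    qed
  qed
  ultimately show ?thesis using that mF lm root by blast
qed

end


section \<open>Extending homomorphisms of intermediate rings\<close>

locale intermediate_hom = intermediate_ring emb F
  for emb :: "'k::field \<Rightarrow> 'l::field" and F :: "'l set" +
  fixes \<phi> :: "'l \<Rightarrow> 'l"
  assumes fixes_base: "\<phi> (emb c) = emb c"
    and add: "x \<in> F \<Longrightarrow> y \<in> F \<Longrightarrow> \<phi> (x + y) = \<phi> x + \<phi> y"
    and mult: "x \<in> F \<Longrightarrow> y \<in> F \<Longrightarrow> \<phi> (x * y) = \<phi> x * \<phi> y"
begin

lemma zero: "\<phi> 0 = 0" and one: "\<phi> 1 = 1"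
  using fixes_base[of 0] fixes_base[of 1] by simp_all

lemma diff: "x \<in> F \<Longrightarrow> y \<in> F \<Longrightarrow> \<phi> (x - y) = \<phi> x - \<phi> y"
  using add[of "x - y" y] by (simp add: diff_in)

lemma sum: "(\<And>i. i \<in> I \<Longrightarrow> f i \<in> F) \<Longrightarrow> \<phi> (sum f I) = (\<Sum>i\<in>I. \<phi> (f i))"
  by (induction I rule: infinite_finite_induct) (auto simp: zero add sum_in)

lemma map_poly_add:
  "p \<in> polys_over F \<Longrightarrow> q \<in> polys_over F \<Longrightarrow> map_poly \<phi> (p + q) = map_poly \<phi> p + map_poly \<phi> q"
  by (auto simp: poly_eq_iff coeff_map_poly zero polys_over_def add)

lemma map_poly_diff:
  "p \<in> polys_over F \<Longrightarrow> q \<in> polys_over F \<Longrightarrow> map_poly \<phi> (p - q) = map_poly \<phi> p - map_poly \<phi> q"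
  by (auto simp: poly_eq_iff coeff_map_poly zero polys_over_def diff)

lemma map_poly_mult:
  "p \<in> polys_over F \<Longrightarrow> q \<in> polys_over F \<Longrightarrow> map_poly \<phi> (p * q) = map_poly \<phi> p * map_poly \<phi> q"
  by (auto simp: poly_eq_iff coeff_map_poly zero polys_over_def coeff_mult sum mult mult_in)

lemma map_poly_base: "map_poly \<phi> (map_poly emb p) = map_poly emb p"
  by (auto simp: poly_eq_iff coeff_map_poly zero fixes_base)

text \<open>
  The extension sends \<open>f(a)\<close> to \<open>(\<phi> f)(r)\<close>; the hypothesis on \<open>r\<close> is exactly what makes
  this independent of the choice of \<open>f\<close>.
\<close>

lemma extend_to_element:
  assumes root: "\<And>f. f \<in> polys_over F \<Longrightarrow> poly f a = 0 \<Longrightarrow> poly (map_poly \<phi> f) r = 0"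
  obtains F' \<psi> where "intermediate_hom emb F' \<psi>" "F \<subseteq> F'" "a \<in> F'" "\<psi> a = r"
    "\<And>x. x \<in> F \<Longrightarrow> \<psi> x = \<phi> x"
proof -
  define F' where "F' = (\<lambda>f. poly f a) ` polys_over F"
  define rep where "rep x = (SOME f. f \<in> polys_over F \<and> poly f a = x)" for x
  define \<psi> where "\<psi> x = poly (map_poly \<phi> (rep x)) r" for x
  have \<psi>: "\<psi> (poly f a) = poly (map_poly \<phi> f) r" if f: "f \<in> polys_over F" for f
  proof -
    have "rep (poly f a) \<in> polys_over F \<and> poly (rep (poly f a)) a = poly f a"
      unfolding rep_def by (rule someI[of _ f]) (use f in simp)
    then show ?thesis
      using root[of "rep (poly f a) - f"] f
      by (simp add: \<psi>_def polys_over_diff map_poly_diff)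
  qed
  have const: "c \<in> F' \<and> \<psi> c = \<phi> c" if "c \<in> F" for c
  proof
    show "c \<in> F'"
      unfolding F'_def using polys_over_const[OF that] by (intro image_eqI[of _ _ "[:c:]"]) auto
    show "\<psi> c = \<phi> c"
      using \<psi>[OF polys_over_const[OF that]] by (simp add: map_poly_simps zero)
  qed
  have X: "[:0, 1:] \<in> polys_over F"
    using polys_over_monom[of 1 1] by (simp add: one_in monom_altdef)
  have "a \<in> F' \<and> \<psi> a = r"
    using \<psi>[OF X] X by (force simp: F'_def map_poly_simps zero one)
  moreover have "intermediate_hom emb F' \<psi>"
  proof unfold_locales
    fix c show "emb c \<in> F'" "\<psi> (emb c) = emb c"
      using const[OF base_in[of c]] fixes_base by auto
  next
    fix x y assume "x \<in> F'" "y \<in> F'"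
    then obtain f g where fg: "f \<in> polys_over F" "x = poly f a" "g \<in> polys_over F" "y = poly g a"
      by (auto simp: F'_def)
    have eq: "x + y = poly (f + g) a" "x * y = poly (f * g) a" using fg by simp_all
    show "x + y \<in> F'" "x * y \<in> F'"
      using fg polys_over_add polys_over_mult unfolding eq F'_def by blast+
    show "\<psi> (x + y) = \<psi> x + \<psi> y" "\<psi> (x * y) = \<psi> x * \<psi> y"
      unfolding eq using fg
      by (simp_all add: \<psi> polys_over_add polys_over_mult map_poly_add map_poly_mult del: poly_add poly_mult)
        (simp_all add: \<psi>)
  qed
  ultimately show ?thesis using that const by blast
qed

end

lemma root_of_factor_of_split_poly:
  fixes q :: "'a::field poly"
  assumes "poly_splits g" "g \<noteq> 0" "q dvd g" "degree q > 0"
  shows "\<exists>r. poly q r = 0"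
proof -
  obtain c as where g: "g = smult c (\<Prod>a\<leftarrow>as. [:- a, 1:])"
    using assms(1) by (auto simp: poly_splits_def)
  then have "q dvd (\<Prod>a\<leftarrow>as. [:- a, 1:])"
    using assms(2,3) by (simp add: dvd_smult_iff)
  then show ?thesis
    using assms(4)
  proof (induction as arbitrary: q)
    case Nil
    then have "q dvd 1" "q \<noteq> 0" by auto
    then show ?case using Nil.prems(2) by (simp add: is_unit_iff_degree)
  next
    case (Cons a as)
    from Cons.prems(1) obtain h where h: "[:- a, 1:] * (\<Prod>a\<leftarrow>as. [:- a, 1:]) = q * h"
      unfolding list.map prod_list.Cons by (rule dvdE)
    show ?case
    proof (cases "poly q a = 0")
      case False
      have "poly (q * h) a = 0" by (simp flip: h)
      then obtain h' where "h = [:- a, 1:] * h'"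
        using False by (auto simp: poly_eq_0_iff_dvd elim: dvdE)
      then have "[:- a, 1:] * (\<Prod>a\<leftarrow>as. [:- a, 1:]) = [:- a, 1:] * (q * h')"
        using h by (simp add: mult.left_commute)
      then have "(\<Prod>a\<leftarrow>as. [:- a, 1:]) = q * h'"
        by (subst (asm) mult_cancel_left) auto
      then show ?thesis using Cons by auto
    qed blast
  qed
qed

text \<open>
  Normality enters here: the minimal polynomial of \<open>a\<close> over \<open>F\<close> divides the one over the
  base field, which is unchanged by \<open>\<phi>\<close> and splits, so the image under \<open>\<phi>\<close> of the former
  has a root.
\<close>

lemma (in intermediate_hom) admissible_image_exists:
  assumes normal: "normal_ext emb"
  obtains r where "\<And>f. f \<in> polys_over F \<Longrightarrow> poly f a = 0 \<Longrightarrow> poly (map_poly \<phi> f) r = 0"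
proof -
  interpret P: map_poly_inj_idom_hom emb ..
  have alg: "algebraic_ext emb" using normal by (simp add: normal_ext_def)
  obtain p where p: "irreducible p" "p \<noteq> 0" "poly (map_poly emb p) a = 0"
    using minimal_poly_exists[OF field_hom_axioms alg] by metis
  obtain m where m: "m \<in> polys_over F" "lead_coeff m = 1" "degree m > 0"
    "\<And>f. f \<in> polys_over F \<Longrightarrow> poly f a = 0 \<Longrightarrow> \<exists>q\<in>polys_over F. f = m * q"
    using minimal_poly_over_exists[OF alg, of a] by metis
  have "map_poly \<phi> m dvd map_poly emb p"
    using m(4)[OF polys_over_base p(3)] map_poly_mult[OF m(1)] map_poly_base
    by (metis dvd_triv_left)
  moreover have "poly_splits (map_poly emb p)"
    using normal p by (auto simp: normal_ext_def)
  moreover have "degree (map_poly \<phi> m) > 0"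
  proof -
    have "coeff (map_poly \<phi> m) (degree m) \<noteq> 0"
      using m(2) by (simp add: coeff_map_poly zero one)
    then show ?thesis using m(3) le_degree by fastforce
  qed
  ultimately obtain r where "poly (map_poly \<phi> m) r = 0"
    using root_of_factor_of_split_poly[of "map_poly emb p" "map_poly \<phi> m"] p(2) by auto
  then have "poly (map_poly \<phi> f) r = 0" if "f \<in> polys_over F" "poly f a = 0" for f
    using m(4)[OF that] map_poly_mult[OF m(1)] by auto
  then show ?thesis using that by blast
qed

lemma extend_to_finite_set:
  assumes "finite A" "normal_ext emb" "intermediate_hom emb F \<phi>"
  shows "\<exists>F' \<psi>. intermediate_hom emb F' \<psi> \<and> F \<subseteq> F' \<and> A \<subseteq> F' \<and> (\<forall>x\<in>F. \<psi> x = \<phi> x)"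
  using assms(1)
proof induction
  case empty
  then show ?case using assms(3) by blast
next
  case (insert a A)
  then obtain E \<chi> where E: "intermediate_hom emb E \<chi>" "F \<subseteq> E" "A \<subseteq> E" "\<forall>x\<in>F. \<chi> x = \<phi> x"
    by blast
  interpret E: intermediate_hom emb E \<chi> by fact
  obtain r where "\<And>f. f \<in> polys_over E \<Longrightarrow> poly f a = 0 \<Longrightarrow> poly (map_poly \<chi> f) r = 0"
    using E.admissible_image_exists[OF assms(2)] by metis
  from E.extend_to_element[OF this] obtain F' \<psi> where
    "intermediate_hom emb F' \<psi>" "E \<subseteq> F'" "a \<in> F'" "\<And>x. x \<in> E \<Longrightarrow> \<psi> x = \<chi> x"
    by metis
  with E show ?case by (intro exI[of _ F'] exI[of _ \<psi>]) auto
qed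

text \<open>
  Surjectivity holds because an injective endomorphism maps the finite root set of each
  polynomial over the base field into itself, hence onto itself.
\<close>

lemma intermediate_hom_UNIV_in_galois_group:
  assumes alg: "algebraic_ext emb" and hom: "intermediate_hom emb UNIV \<psi>"
  shows "\<psi> \<in> carrier (galois_group emb)"
proof -
  interpret intermediate_hom emb UNIV \<psi> by fact
  have hom: "field_hom \<psi>"
    by unfold_locales (simp_all add: zero one add mult)
  interpret psi: field_hom \<psi> by fact
  have "y \<in> range \<psi>" for y
  proof -
    obtain p where p: "p \<noteq> 0" "poly (map_poly emb p) y = 0"
      using alg unfolding algebraic_ext_def by blast
    let ?R = "{x. poly (map_poly emb p) x = 0}"
    have "poly (map_poly emb p) (\<psi> x) = \<psi> (poly (map_poly emb p) x)" for x
      by (metis map_poly_base psi.poly_map_poly)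
    then have "\<psi> ` ?R \<subseteq> ?R" by (auto simp: zero)
    moreover have "finite ?R" using p by (intro poly_roots_finite) simp
    ultimately have "\<psi> ` ?R = ?R"
      by (intro endo_inj_surj) (auto intro: inj_onI psi.injectivity)
    then show ?thesis using p(2) by blast
  qed
  then have "bij \<psi>"
    by (auto simp: bij_def intro: injI psi.injectivity)
  then show ?thesis
    using hom by (simp add: galois_group_def fixes_base)
qed


section \<open>The fixed field of the Galois group\<close>

lemma finite_spanning_set_exists:
  assumes "field_hom emb" "ext_degree emb > 0"
  obtains A where "finite A" "module.span (ext_scale emb) A = UNIV"
proof -
  interpret vector_space "ext_scale emb"
    using assms(1) by (rule vector_space_ext_scale)
  obtain B where B: "independent B" "span B = UNIV"
    using basis_exists[of UNIV] by (metis UNIV_I subset_UNIV subset_antisym)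
  then have "card B > 0"
    using assms(2) dim_eq_card[of B UNIV] by (simp add: ext_degree_def)
  then show ?thesis using that B card_gt_0_iff by blast
qed

text \<open>
  Separability enters here. If \<open>x\<close> were the only root of its minimal polynomial \<open>p\<close>, then
  \<open>p = c (X - x)^d\<close> with \<open>d \<ge> 2\<close>, so \<open>p'(x) = 0\<close>; minimality forces \<open>p' = 0\<close>, which
  is not coprime to \<open>p\<close>.
\<close>

lemma second_root_exists:
  fixes emb :: "'k::field \<Rightarrow> 'l::field"
  assumes gal: "galois_ext emb" and x: "x \<notin> range emb"
  obtains y where "y \<noteq> x"
    "\<And>f. poly (map_poly emb f) x = 0 \<Longrightarrow> poly (map_poly emb f) y = 0"
proof -
  interpret field_hom emb using gal by (simp add: galois_ext_def)
  interpret P: map_poly_inj_idom_hom emb ..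
  have alg: "algebraic_ext emb" using gal by (simp add: galois_ext_def normal_ext_def)
  obtain p where p: "irreducible p" "p \<noteq> 0" "poly (map_poly emb p) x = 0"
    "\<And>q. q \<noteq> 0 \<Longrightarrow> poly (map_poly emb q) x = 0 \<Longrightarrow> degree p \<le> degree q"
    using minimal_poly_exists[OF field_hom_axioms alg] by metis
  have dvd: "p dvd f" if "poly (map_poly emb f) x = 0" for f
  proof -
    have "map_poly emb f = map_poly emb (f div p) * map_poly emb p + map_poly emb (f mod p)"
      by (simp only: div_mult_mod_eq flip: P.hom_mult P.hom_add)
    then have "poly (map_poly emb (f mod p)) x = 0"
      using that p(3) by simp
    then have "f mod p = 0"
      by (meson p(2,4) degree_mod_less' not_less)
    then show ?thesis by (simp add: mod_eq_0_iff_dvd)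
  qed
  obtain c as where split: "map_poly emb p = smult c (\<Prod>a\<leftarrow>as. [:- a, 1:])"
    using gal p by (auto simp: galois_ext_def normal_ext_def poly_splits_def)
  have cop: "coprime p (pderiv p)"
    using gal p by (auto simp: galois_ext_def separable_ext_def)
  have "\<exists>y\<in>set as. y \<noteq> x"
  proof (rule ccontr)
    assume "\<not> (\<exists>y\<in>set as. y \<noteq> x)"
    then have "map (\<lambda>a. [:- a, 1:]) as = replicate (length as) [:- x, 1:]"
      by (induction as) auto
    then have pow: "map_poly emb p = smult c ([:- x, 1:] ^ length as)"
      using split by simp
    have "c \<noteq> 0" using split p(2) by auto
    then have "degree p = length as"
      using degree_map_poly_hom[of p] by (simp add: pow degree_linear_power)
    moreover have "degree p \<ge> 2"
    proof (rule ccontr)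
      assume "\<not> degree p \<ge> 2"
      obtain s q where sq: "p = pCons s q" by (cases p)
      with \<open>\<not> degree p \<ge> 2\<close> have "degree q = 0"
        by (simp split: if_splits)
      then obtain t where "q = [:t:]" by (rule degree_eq_zeroE)
      with sq have st: "p = [:s, t:]" by simp
      from p(3) have eq: "emb s + x * emb t = 0"
        by (simp add: st hom_distribs)
      have "t \<noteq> 0"
      proof
        assume "t = 0"
        with eq st p(2) show False by simp
      qed
      then have "x = emb (- s / t)"
        using eq by (simp add: hom_distribs field_simps eq_neg_iff_add_eq_0)
      with x show False by blast
    qed
    ultimately obtain d where "length as = Suc (Suc d)"
      by (metis add_2_eq_Suc le_Suc_ex)
    then have "poly (pderiv (map_poly emb p)) x = 0"
      by (simp add: pow pderiv_smult pderiv_mult del: mult_pCons_left)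
    moreover have "map_poly emb (pderiv p) = pderiv (map_poly emb p)"
      by (auto simp: poly_eq_iff coeff_map_poly coeff_pderiv hom_distribs)
    ultimately have "poly (map_poly emb (pderiv p)) x = 0" by simp
    then have "p dvd pderiv p" by (rule dvd)
    with cop have "p dvd 1" by (meson coprime_common_divisor dvd_refl)
    with irreducible_not_unit[OF p(1)] show False by contradiction
  qed
  then obtain y where y: "y \<in> set as" "y \<noteq> x" by blast
  have "poly (map_poly emb p) y = 0"
    using y(1) by (auto simp: split poly_prod_list prod_list_zero_iff)
  then have "poly (map_poly emb f) y = 0" if "poly (map_poly emb f) x = 0" for f
    using dvd[OF that] by (auto simp: hom_distribs elim!: dvdE)
  then show ?thesis using that y(2) by blast
qed

text \<open>
  An element outside \<open>K\<close> is moved by the automorphism obtained by sending it to another root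
  of its minimal polynomial and extending along a finite spanning set. Positive degree
  expresses that such a spanning set exists.
\<close>

theorem galois_group_fixed_field:
  assumes gal: "galois_ext emb" and deg: "ext_degree emb > 0"
    and fixed: "\<And>\<tau>. \<tau> \<in> carrier (galois_group emb) \<Longrightarrow> \<tau> x = x"
  shows "x \<in> range emb"
proof (rule ccontr)
  assume x: "x \<notin> range emb"
  interpret field_hom emb using gal by (simp add: galois_ext_def)
  have normal: "normal_ext emb" using gal by (simp add: galois_ext_def)
  obtain y where y: "y \<noteq> x"
    "\<And>f. poly (map_poly emb f) x = 0 \<Longrightarrow> poly (map_poly emb f) y = 0"
    using second_root_exists[OF gal x] by metis
  interpret id: intermediate_hom emb "range emb" id
    by unfold_locales (auto simp flip: hom_distribs)
  have "poly (map_poly id f) y = 0" if "f \<in> polys_over (range emb)" "poly f x = 0" for f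
  proof -
    have "map_poly emb (map_poly (inv_into UNIV emb) f) = f"
      using that(1) by (auto simp: poly_eq_iff coeff_map_poly polys_over_def f_inv_into_f
        inv_f_eq[OF injI[OF injectivity]])
    then show ?thesis using y(2) that(2) by (metis map_poly_id)
  qed
  from id.extend_to_element[OF this] obtain E \<chi> where
    E: "intermediate_hom emb E \<chi>" "x \<in> E" "\<chi> x = y" by metis
  obtain A where A: "finite A" "module.span (ext_scale emb) A = UNIV"
    using finite_spanning_set_exists[OF field_hom_axioms deg] by metis
  obtain F \<psi> where F: "intermediate_hom emb F \<psi>" "E \<subseteq> F" "A \<subseteq> F" "\<forall>z\<in>E. \<psi> z = \<chi> z"
    using extend_to_finite_set[OF A(1) normal E(1)] by blast
  interpret F: intermediate_hom emb F \<psi> by fact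
  interpret vector_space "ext_scale emb"
    using field_hom_axioms by (rule vector_space_ext_scale)
  have "subspace F"
    by (auto simp: subspace_def ext_scale_def F.zero_in F.add_in F.mult_in F.base_in)
  then have "F = UNIV"
    using span_minimal[OF F(3)] A(2) by auto
  then have "\<psi> \<in> carrier (galois_group emb)"
    using F(1) normal by (auto simp: normal_ext_def intro: intermediate_hom_UNIV_in_galois_group)
  then have "\<psi> x = x" by (rule fixed)
  with F(4) E y(1) show False by auto
qed

lemma fixed_by_generator_fixed_by_group:
  assumes \<sigma>: "\<sigma> \<in> carrier (galois_group emb)" and x: "\<sigma> x = x"
    and \<tau>: "\<tau> \<in> generate (galois_group emb) {\<sigma>}"
  shows "\<tau> x = x"
  using \<tau>
proof induction
  case (inv h)
  interpret group "galois_group emb" by (rule group_galois_group)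
  have "inv\<^bsub>galois_group emb\<^esub> \<sigma> \<circ> \<sigma> = id"
    using l_inv[OF \<sigma>] by (simp add: galois_group_def)
  then show ?case using inv x by (metis comp_apply id_apply singletonD)
qed (auto simp: galois_group_def x)


section \<open>Casoratian determinants\<close>

lemma det_eq_0_iff_column_relation:
  fixes M :: "nat \<Rightarrow> nat \<Rightarrow> 'a::field"
  shows "det (mat k k (\<lambda>(i, j). M i j)) = 0 \<longleftrightarrow>
    (\<exists>c. (\<exists>j<k. c j \<noteq> 0) \<and> (\<forall>i<k. (\<Sum>j<k. c j * M i j) = 0))"
proof -
  let ?M = "mat k k (\<lambda>(i, j). M i j)"
  have row: "(?M *\<^sub>v vec k c) $ i = (\<Sum>j<k. c j * M i j)" if "i < k" for c i
    using that by (auto simp: scalar_prod_def lessThan_atLeast0 mult.commute intro!: sum.cong)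
  have iff: "vec k c \<noteq> 0\<^sub>v k \<and> ?M *\<^sub>v vec k c = 0\<^sub>v k \<longleftrightarrow>
    (\<exists>j<k. c j \<noteq> 0) \<and> (\<forall>i<k. (\<Sum>j<k. c j * M i j) = 0)" for c
    using row[of _ c] by (auto simp: vec_eq_iff)
  have "det ?M = 0 \<longleftrightarrow> (\<exists>v. v \<in> carrier_vec k \<and> v \<noteq> 0\<^sub>v k \<and> ?M *\<^sub>v v = 0\<^sub>v k)"
    by (rule det_0_iff_vec_prod_zero_field) simp
  also have "\<dots> \<longleftrightarrow> (\<exists>c. vec k c \<noteq> 0\<^sub>v k \<and> ?M *\<^sub>v vec k c = 0\<^sub>v k)"
  proof -
    have "v = vec k (($) v)" if "v \<in> carrier_vec k" for v :: "'a vec"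
      using that by auto
    then show ?thesis by (metis vec_carrier)
  qed
  finally show ?thesis by (simp only: iff)
qed

text \<open>
  A relation of minimal length, normalised to have last coefficient 1, must have coefficients
  fixed by \<open>\<sigma>\<close>: subtracting it from its \<open>\<sigma>\<close>-image kills the last coefficient and leaves, one
  row further down, a shorter relation with coefficients \<open>\<sigma> c\<^sub>j - c\<^sub>j\<close>. The first row then
  is the wanted relation.
\<close>

lemma column_relation_over_fixed_field:
  fixes \<sigma> :: "'l::field \<Rightarrow> 'l"
  assumes "field_hom \<sigma>" "bij \<sigma>"
    and "\<exists>j<k. c j \<noteq> 0" "\<forall>i<k. (\<Sum>j<k. c j * (\<sigma> ^^ i) (b j)) = 0"
  shows "\<exists>d. (\<exists>j<k. d j \<noteq> 0) \<and> (\<forall>j<k. \<sigma> (d j) = d j) \<and> (\<Sum>j<k. d j * b j) = 0"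
  using assms(3,4)
proof (induction k arbitrary: c)
  case (Suc k)
  interpret field_hom \<sigma> by fact
  show ?case
  proof (cases "\<exists>e. (\<exists>j<k. e j \<noteq> 0) \<and> (\<forall>i<k. (\<Sum>j<k. e j * (\<sigma> ^^ i) (b j)) = 0)")
    case True
    then obtain d where d: "\<exists>j<k. d j \<noteq> 0" "\<forall>j<k. \<sigma> (d j) = d j" "(\<Sum>j<k. d j * b j) = 0"
      using Suc.IH by blast
    then show ?thesis
      by (intro exI[of _ "\<lambda>j. if j < k then d j else 0"]) (auto simp: less_Suc_eq)
  next
    case no_shorter: False
    have "c k \<noteq> 0"
    proof
      assume "c k = 0"
      then have "\<exists>j<k. c j \<noteq> 0" "\<forall>i<k. (\<Sum>j<k. c j * (\<sigma> ^^ i) (b j)) = 0"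
        using Suc.prems by (auto simp: less_Suc_eq)
      with no_shorter show False by blast
    qed
    define d where "d j = c j / c k" for j
    have dk: "d k = 1" using \<open>c k \<noteq> 0\<close> by (simp add: d_def)
    have rel: "(\<Sum>j<Suc k. d j * (\<sigma> ^^ i) (b j)) = 0" if "i < Suc k" for i
    proof -
      have "(\<Sum>j<Suc k. d j * (\<sigma> ^^ i) (b j)) = (\<Sum>j<Suc k. c j * (\<sigma> ^^ i) (b j)) / c k"
        by (simp only: d_def sum_divide_distrib times_divide_eq_left)
      then show ?thesis using Suc.prems(2) that by simp
    qed
    have inv: "\<sigma> (inv_into UNIV \<sigma> z) = z" for z
      using assms(2) by (simp add: bij_is_surj surj_f_inv_f)
    define e where "e j = inv_into UNIV \<sigma> (\<sigma> (d j) - d j)" for j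
    (* Applying the inverse of \<sigma> moves the shorter relation from rows 1..k to rows 0..k-1. *)
    have "(\<Sum>j<k. e j * (\<sigma> ^^ i) (b j)) = 0" if "i < k" for i
    proof -
      have "\<sigma> (\<Sum>j<k. e j * (\<sigma> ^^ i) (b j)) = (\<Sum>j<k. (\<sigma> (d j) - d j) * (\<sigma> ^^ Suc i) (b j))"
        by (simp add: hom_distribs e_def inv)
      also have "\<dots> = (\<Sum>j<Suc k. (\<sigma> (d j) - d j) * (\<sigma> ^^ Suc i) (b j))"
        by (simp add: dk)
      also have "\<dots> = \<sigma> (\<Sum>j<Suc k. d j * (\<sigma> ^^ i) (b j)) - (\<Sum>j<Suc k. d j * (\<sigma> ^^ Suc i) (b j))"
        by (simp only: hom_distribs left_diff_distrib sum_subtractf funpow.simps comp_apply)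
      also have "\<dots> = 0" using rel[of i] rel[of "Suc i"] that by simp
      finally show ?thesis by (simp only: hom_0_iff)
    qed
    with no_shorter have "\<forall>j<k. e j = 0" by blast
    then have "\<sigma> (d j) = d j" if "j < k" for j
      using that inv[of "\<sigma> (d j) - d j"] by (simp add: e_def)
    then have "\<forall>j<Suc k. \<sigma> (d j) = d j" by (auto simp: less_Suc_eq dk)
    moreover have "(\<Sum>j<Suc k. d j * b j) = 0" using rel[of 0] by simp
    moreover have "\<exists>j<Suc k. d j \<noteq> 0" using dk by auto
    ultimately show ?thesis by blast
  qed
qed simp


section \<open>Linear dependence and the determinant\<close>

theorem theorem1p4:
  fixes emb :: "'k::field \<Rightarrow> 'l::field"
    and \<sigma> :: "'l \<Rightarrow> 'l"
    and n k :: nat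
    and b :: "nat \<Rightarrow> 'l"
  assumes galois: "galois_ext emb"
    and degree: "ext_degree emb = n"
    and sigma: "\<sigma> \<in> carrier (galois_group emb)"
    and cyclic: "carrier (galois_group emb) = generate (galois_group emb) {\<sigma>}"
    and k: "1 \<le> k" "k \<le> n"
  shows "lin_dep_family emb {1..k} b \<longleftrightarrow>
           det (mat k k (\<lambda>(i, j). (\<sigma> ^^ i) (b (j + 1)))) = 0"
proof -
  have \<sigma>: "field_hom \<sigma>" "bij \<sigma>" "\<And>a. \<sigma> (emb a) = emb a"
    using sigma by (auto simp: galois_group_def)
  interpret emb: field_hom emb using galois by (simp add: galois_ext_def)
  interpret field_hom \<sigma> by fact
  have fixed: "x \<in> range emb" if "\<sigma> x = x" for x
    using galois_group_fixed_field[OF galois] degree k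
      fixed_by_generator_fixed_by_group[OF sigma that] cyclic by auto
  have lin_dep: "lin_dep_family emb {1..k} b \<longleftrightarrow>
      (\<exists>c. (\<exists>j<k. c j \<noteq> 0) \<and> (\<Sum>j<k. emb (c j) * b (j + 1)) = 0)"
  proof
    assume "lin_dep_family emb {1..k} b"
    then obtain c i where c: "i \<in> {1..k}" "c i \<noteq> 0" "(\<Sum>i\<in>{1..k}. emb (c i) * b i) = 0"
      by (auto simp: lin_dep_family_def ext_scale_def)
    have "(\<Sum>j<k. emb (c (j + 1)) * b (j + 1)) = 0"
      using c(3) sum.atLeast1_atMost_eq[of "\<lambda>i. emb (c i) * b i" k] by simp
    moreover have "\<exists>j<k. c (j + 1) \<noteq> 0"
      using c(1,2) by (intro exI[of _ "i - 1"]) auto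
    ultimately show "\<exists>c. (\<exists>j<k. c j \<noteq> 0) \<and> (\<Sum>j<k. emb (c j) * b (j + 1)) = 0"
      by (intro exI[of _ "\<lambda>j. c (j + 1)"]) blast
  next
    assume "\<exists>c. (\<exists>j<k. c j \<noteq> 0) \<and> (\<Sum>j<k. emb (c j) * b (j + 1)) = 0"
    then obtain c j where c: "j < k" "c j \<noteq> 0" "(\<Sum>j<k. emb (c j) * b (j + 1)) = 0"
      by blast
    have "(\<Sum>i\<in>{1..k}. ext_scale emb (c (i - 1)) (b i)) = 0"
      using c(3) by (simp add: ext_scale_def sum.atLeast1_atMost_eq)
    moreover have "c (j + 1 - 1) \<noteq> 0" "j + 1 \<in> {1..k}" using c by auto
    ultimately show "lin_dep_family emb {1..k} b"
      unfolding lin_dep_family_def by (intro exI[of _ "\<lambda>i. c (i - 1)"] conjI bexI[of _ "j + 1"])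
  qed
  show ?thesis
    unfolding det_eq_0_iff_column_relation lin_dep
  proof
    assume "\<exists>c. (\<exists>j<k. c j \<noteq> 0) \<and> (\<Sum>j<k. emb (c j) * b (j + 1)) = 0"
    then obtain c where c: "\<exists>j<k. c j \<noteq> 0" "(\<Sum>j<k. emb (c j) * b (j + 1)) = 0" by blast
    have "(\<Sum>j<k. emb (c j) * (\<sigma> ^^ i) (b (j + 1))) = 0" for i
    proof (induction i)
      case (Suc i)
      have "(\<Sum>j<k. emb (c j) * (\<sigma> ^^ Suc i) (b (j + 1))) =
          \<sigma> (\<Sum>j<k. emb (c j) * (\<sigma> ^^ i) (b (j + 1)))"
        by (simp add: hom_distribs \<sigma>(3))
      then show ?case using Suc by simp
    qed (use c in simp)
    then show "\<exists>c. (\<exists>j<k. c j \<noteq> 0) \<and> (\<forall>i<k. (\<Sum>j<k. c j * (\<sigma> ^^ i) (b (j + 1))) = 0)"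
      using c(1) by (intro exI[of _ "\<lambda>j. emb (c j)"]) simp
  next
    assume "\<exists>c. (\<exists>j<k. c j \<noteq> 0) \<and> (\<forall>i<k. (\<Sum>j<k. c j * (\<sigma> ^^ i) (b (j + 1))) = 0)"
    then obtain d where d: "\<exists>j<k. d j \<noteq> 0" "\<forall>j<k. \<sigma> (d j) = d j" "(\<Sum>j<k. d j * b (j + 1)) = 0"
      using column_relation_over_fixed_field[OF \<sigma>(1,2), where b = "\<lambda>j. b (j + 1)"] by blast
    then have "\<forall>j<k. \<exists>c. d j = emb c" using fixed by blast
    then obtain c where "\<forall>j<k. d j = emb (c j)" by metis
    with d show "\<exists>c. (\<exists>j<k. c j \<noteq> 0) \<and> (\<Sum>j<k. emb (c j) * b (j + 1)) = 0"
      by (intro exI[of _ c]) auto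
  qed
qed

end
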